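(* Let $\beta(N)$ denote the base phi representation of the positive integer $N$, and let $(L_n)_{n\ge 0}$ be the Lucas numbers. **I.** For all $n\ge 1$ and all $k=1,\dots,L_{2n-1}$, $$\beta(L_{2n}+k)=\beta(L_{2n})+\beta(k)=10\dots 0\,\beta(k)\,0\dots 01,$$ where $+$ denotes digitwise addition (aligned at the radix point, with no carries), and where the word on the right is obtained from $\beta(k)$ by placing a digit $1$ at position $2n$ and a digit $1$ at position $-2n$, and filling with $0$'s the positions between these two digits and $\beta(k)$. **II.** For all $n\ge 2$ and all $k=1,\dots,L_{2n-2}-1$ (the intervals $I_n$ and $K_n$, respectively), $$\beta(L_{2n+1}+k)=1000\,(10)^{-1}\,\beta(L_{2n-1}+k)\,(01)^{-1}\,1001,$$ $$\beta(L_{2n+1}+L_{2n-1}+k)=1010\,(10)^{-1}\,\beta(L_{2n-1}+k)\,(01)^{-1}\,0001.$$ Moreover, for all $n\ge 2$ and all $k=0,\dots,L_{2n-3}$ (the interval $J_n$), $$\beta(L_{2n+1}+L_{2n-2}+k)=10010\,(10)^{-1}\,\beta(L_{2n-2}+k)\,(01)^{-1}\,001001.$$ The equalities in Part II are equalities of words (including the position of the radix point), evaluated in the free group on the letters $0$, $1$ and the radix point.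
   Context: Let $\varphi=(1+\sqrt5)/2$. Every positive integer $N$ can be written uniquely as $N=\sum_{i} d_i\varphi^i$, where $i$ ranges over $\mathbb{Z}$, each $d_i\in\{0,1\}$, only finitely many $d_i$ are nonzero, and $d_id_{i+1}=0$ for all $i$ (no two consecutive digits equal to $1$). The base phi representation of $N$ is the word, with radix point, $$\beta(N)=d_Ld_{L-1}\dots d_1d_0\cdot d_{-1}d_{-2}\dots d_{R+1}d_R,$$ where leading and trailing zeros are dropped, i.e. $L$ is the largest and $R$ the smallest index $i$ with $d_i=1$. For example $\beta(1)=1\cdot$, $\beta(2)=10\cdot 01$, $\beta(3)=100\cdot 01$, $\beta(4)=101\cdot 01$, $\beta(5)=1000\cdot 1001$. The digit $d_i$ is said to be at position $i$. The Lucas numbers are defined by $L_0=2$, $L_1=1$, $L_n=L_{n-1}+L_{n-2}$ for $n\ge 2$. For $n\ge 2$ the intervals of integers $I_n$, $J_n$, $K_n$ are $$I_n=[L_{2n+1}+1,\,L_{2n+1}+L_{2n-2}-1],$$ $$J_n=[L_{2n+1}+L_{2n-2},\,L_{2n+1}+L_{2n-1}],$$ $$K_n=[L_{2n+1}+L_{2n-1}+1,\,L_{2n+2}-1].$$ Free group notation for words: juxtaposition is concatenation, and $w^{-1}$ is the formal inverse of the word $w$, so for example $(01)^{-1}0001=1^{-1}001$. In particular, $(10)^{-1}\beta(N)$ removes the prefix $10$ from $\beta(N)$ when $\beta(N)$ begins with $10$, and $\beta(N)(01)^{-1}$ removes the suffix $01$ from $\beta(N)$ when $\beta(N)$ ends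 with $01$. *)

theory Defs
  imports Complex_Main
begin

section \<open>Lucas numbers\<close>

fun lucas :: "nat \<Rightarrow> nat" where
  "lucas 0 = 2"
| "lucas (Suc 0) = 1"
| "lucas (Suc (Suc n)) = lucas (Suc n) + lucas n"

section \<open>Base phi representation\<close>

definition phi :: real where
  "phi = (1 + sqrt 5) / 2"

definition is_phi_expansion :: "nat \<Rightarrow> (int \<Rightarrow> nat) \<Rightarrow> bool" where
  "is_phi_expansion N d \<longleftrightarrow>
     (\<forall>i. d i \<in> {0, 1}) \<and> finite {i. d i \<noteq> 0} \<and> (\<forall>i. d i * d (i + 1) = 0) \<and>
     real N = (\<Sum>i\<in>{i. d i \<noteq> 0}. real (d i) * phi powi i)"

definition phi_digits :: "nat \<Rightarrow> int \<Rightarrow> nat" where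
  "phi_digits N = (THE d. is_phi_expansion N d)"

definition high_pos :: "nat \<Rightarrow> int" where
  "high_pos N = Max {i. phi_digits N i \<noteq> 0}"

definition low_pos :: "nat \<Rightarrow> int" where
  "low_pos N = Min {i. phi_digits N i \<noteq> 0}"

datatype letter = Zero | One | Point

definition digit_letter :: "nat \<Rightarrow> letter" where
  "digit_letter a = (if a = 0 then Zero else One)"

text \<open>
  The list \<open>[i..j]\<close> is empty for \<open>i > j\<close>, so the word of \<open>1\<close> is \<open>[One, Point]\<close>:
  the radix point is kept, and nothing follows it.
\<close>

definition beta :: "nat \<Rightarrow> letter list" where
  "beta N =
     map (digit_letter \<circ> phi_digits N) (rev [0..high_pos N]) @ [Point] @
     map (digit_letter \<circ> phi_digits N) (rev [low_pos N..-1])"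

section \<open>Free groups\<close>

text \<open>
  A signed letter \<open>(True, x)\<close> stands for the generator \<open>x\<close> and \<open>(False, x)\<close> for its formal
  inverse. The free group consists of the words in signed letters modulo the equivalence
  generated by cancelling adjacent mutually inverse letters.
\<close>

definition flip :: "bool \<times> 'a \<Rightarrow> bool \<times> 'a" where
  "flip s = (\<not> fst s, snd s)"

lemma flip_flip [simp]: "flip (flip s) = s"
  by (simp add: flip_def)

inductive cancels :: "(bool \<times> 'a) list \<Rightarrow> (bool \<times> 'a) list \<Rightarrow> bool" where
  "cancels (u @ [s, flip s] @ v) (u @ v)"

lemma cancels_context: "cancels u v \<Longrightarrow> cancels (a @ u @ b) (a @ v @ b)"
proof (induction rule: cancels.induct)
  case (1 u s v)
  show ?case using cancels.intros[of "a @ u" s "v @ b"] by simp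
qed

lemma equivclp_cancels_context:
  "equivclp cancels u v \<Longrightarrow> equivclp cancels (a @ u @ b) (a @ v @ b)"
proof (induction rule: equivclp_induct)
  case base
  show ?case by simp
next
  case (step y z)
  then have "cancels (a @ y @ b) (a @ z @ b) \<or> cancels (a @ z @ b) (a @ y @ b)"
    using cancels_context by blast
  then show ?case using step.IH by (meson equivclp_into_equivclp)
qed

lemma equivclp_cancels_append:
  assumes "equivclp cancels u u'" "equivclp cancels v v'"
  shows "equivclp cancels (u @ v) (u' @ v')"
  using equivclp_cancels_context[OF assms(1), of "[]" v]
    equivclp_cancels_context[OF assms(2), of u' "[]"]
  by (auto intro: equivclp_trans)

lemma equivclp_cancels_inverse:
  "equivclp cancels u v \<Longrightarrow> equivclp cancels (rev (map flip u)) (rev (map flip v))"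
proof (induction rule: equivclp_induct)
  case base
  show ?case by simp
next
  case (step y z)
  have "cancels (rev (map flip p)) (rev (map flip q))" if "cancels p q" for p q :: "(bool \<times> 'a) list"
    using that
  proof (induction rule: cancels.induct)
    case (1 u s v)
    show ?case
      using cancels.intros[of "rev (map flip v)" s "rev (map flip u)"] by simp
  qed
  then show ?case using step by (meson equivclp_into_equivclp)
qed

quotient_type 'a free_group = "(bool \<times> 'a) list" / "equivclp cancels"
  by (rule equivp_evquivclp)

instantiation free_group :: (type) "{monoid_mult, inverse}"
begin

lift_definition one_free_group :: "'a free_group" is "[]" .

lift_definition times_free_group :: "'a free_group \<Rightarrow> 'a free_group \<Rightarrow> 'a free_group"
  is "(@)" by (rule equivclp_cancels_append)

lift_definition inverse_free_group :: "'a free_group \<Rightarrow> 'a free_group"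
  is "\<lambda>u. rev (map flip u)" by (rule equivclp_cancels_inverse)

definition divide_free_group :: "'a free_group \<Rightarrow> 'a free_group \<Rightarrow> 'a free_group" where
  "divide_free_group x y = x * inverse y"

instance
  by standard (transfer; simp)+

end

lemma free_group_right_inverse: "x * inverse x = (1 :: 'a free_group)"
proof transfer
  fix u :: "(bool \<times> 'a) list"
  show "equivclp cancels (u @ rev (map flip u)) []"
  proof (induction u rule: rev_induct)
    case Nil
    show ?case by simp
  next
    case (snoc s u)
    have "cancels ((u @ [s]) @ rev (map flip (u @ [s]))) (u @ rev (map flip u))"
      using cancels.intros[of u s "rev (map flip u)"] by simp
    then show ?case using snoc by (meson equivclp_trans r_into_equivclp)
  qed
qed

lemma free_group_left_inverse: "inverse x * x = (1 :: 'a free_group)"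
proof -
  have "inverse (inverse x) = x" for x :: "'a free_group"
    by transfer (simp add: rev_map comp_def)
  then show ?thesis using free_group_right_inverse[of "inverse x"] by simp
qed

lift_definition word :: "'a list \<Rightarrow> 'a free_group" is "map (Pair True)" .

lemma word_append: "word (u @ v) = word u * word v"
  by transfer simp

text \<open>
  The map \<open>word\<close> is injective, so an equality in the free group between two ordinary words
  is an equality of these words.
\<close>

fun push :: "bool \<times> 'a \<Rightarrow> (bool \<times> 'a) list \<Rightarrow> (bool \<times> 'a) list" where
  "push s [] = [s]"
| "push s (t # w) = (if t = flip s then w else s # t # w)"

fun reduced :: "(bool \<times> 'a) list \<Rightarrow> bool" where
  "reduced (s # t # w) \<longleftrightarrow> t \<noteq> flip s \<and> reduced (t # w)"
| "reduced _ \<longleftrightarrow> True"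

lemma reduced_push: "reduced w \<Longrightarrow> reduced (push s w)"
  by (cases w rule: reduced.cases) auto

lemma push_push: "reduced w \<Longrightarrow> push s (push (flip s) w) = w"
  by (cases w rule: reduced.cases) auto

lemma reduced_foldr_push: "reduced (foldr push w [])"
  by (induction w) (auto intro: reduced_push)

lemma cancels_foldr_push: "cancels u v \<Longrightarrow> foldr push u [] = foldr push v []"
  by (induction rule: cancels.induct) (simp add: push_push reduced_foldr_push)

lemma foldr_push_word: "foldr push (map (Pair True) w) [] = map (Pair True) w"
proof (induction w)
  case (Cons a w)
  then show ?case by (cases w) (auto simp: flip_def)
qed simp

lemma inj_word: "inj word"
proof (rule injI)
  fix u v :: "'a list"
  assume "word u = word v"
  then have "equivclp cancels (map (Pair True) u) (map (Pair True) v)"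
    by transfer
  then have "foldr push (map (Pair True) u) [] = foldr push (map (Pair True) v) []"
    by (induction rule: equivclp_induct) (auto dest: cancels_foldr_push)
  then have "map (Pair True) u = map (Pair True) v"
    by (simp only: foldr_push_word)
  then show "u = v"
    by (simp add: inj_map_eq_map inj_def)
qed

end

theory Submission
  imports Defs
begin

text \<open>
  An expansion in base \<open>\<phi>\<close> without adjacent ones is determined by its value, because digits
  below position \<open>i\<close> sum to less than \<open>\<phi>\<^sup>i\<close>: two expansions of one number must have the same
  greatest digit, and it can be cancelled (\<open>phi_expands_unique\<close>). So every claim about
  \<open>\<beta>(N)\<close> follows once a digit function without adjacent ones and with value \<open>N\<close> is
  exhibited.

  The digit functions come from two identities for Lucas numbers,
  \<open>L\<^bsub>2n\<^esub> = \<phi>\<^bsup>2n\<^esup> + \<phi>\<^bsup>-2n\<^esup>\<close> and \<open>L\<^bsub>2n+1\<^esub> = \<phi>\<^bsup>2n+1\<^esup> - \<phi>\<^bsup>-2n-1\<^esup>\<close>. The first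
  one gives Part I: adding \<open>L\<^bsub>2n\<^esub>\<close> writes ones at the positions \<open>2n\<close> and \<open>-2n\<close>, which a
  zero separates from the digits of \<open>k\<close>. In Part II the numbers on the two sides differ by \<open>L\<^bsub>2n\<^esub>\<close> (on \<open>I\<^sub>n\<close>) or
  \<open>L\<^bsub>2n+1\<^esub>\<close> (on \<open>J\<^sub>n\<close> and \<open>K\<^sub>n\<close>); exchanging the two outer blocks of the word changes the
  value by exactly this number. For \<open>K\<^sub>n\<close>, for instance, a one is written at \<open>2n+1\<close> and
  the last one is moved from \<open>-2n\<close> to \<open>-2n-2\<close>, which changes the value by
  \<open>\<phi>\<^bsup>2n+1\<^esup> - (\<phi>\<^bsup>-2n\<^esup> - \<phi>\<^bsup>-2n-2\<^esup>) = \<phi>\<^bsup>2n+1\<^esup> - \<phi>\<^bsup>-2n-1\<^esup>\<close>.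

  For these exchanges the positions of the outer ones have to be known, and in the \<open>I\<^sub>n\<close> case
  also that the last three digits are \<open>001\<close>, since a one is put at position \<open>-2n+1\<close>. Both are
  properties that the exchanges themselves reproduce, which makes an induction possible
  (\<open>shapes\<close>): numbers in \<open>[L\<^bsub>2m\<^esub>, L\<^bsub>2m+1\<^esub>]\<close> have outer ones at \<open>2m\<close> and \<open>-2m\<close>, and
  numbers strictly between \<open>L\<^bsub>2m+1\<^esub>\<close> and \<open>L\<^bsub>2m+2\<^esub>\<close> have them at \<open>2m+1\<close> and \<open>-2m-2\<close>.
\<close>

section \<open>Phi-expansions of real numbers\<close>

text \<open>
  Real values allow single powers of \<open>\<phi>\<close> to be added and removed, so that an expansion can be
  edited one digit at a time.
\<close>

definition phi_expands :: "real \<Rightarrow> (int \<Rightarrow> nat) \<Rightarrow> bool" where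
  "phi_expands x d \<longleftrightarrow>
     (\<forall>i. d i \<in> {0, 1}) \<and> finite {i. d i \<noteq> 0} \<and> (\<forall>i. d i * d (i + 1) = 0) \<and>
     x = (\<Sum>i\<in>{i. d i \<noteq> 0}. real (d i) * phi powi i)"

lemma is_phi_expansion_iff: "is_phi_expansion N d \<longleftrightarrow> phi_expands (real N) d"
  by (simp add: is_phi_expansion_def phi_expands_def)

lemma phi_gt_1: "phi > 1"
  by (simp add: phi_def real_less_rsqrt)

lemma phi_powi_pos: "phi powi i > 0"
  using phi_gt_1 by simp

lemma phi_powi_add: "phi powi (i + j) = phi powi i * phi powi j"
  using phi_gt_1 by (simp add: power_int_add)

lemma phi_powi_rec:
  assumes "j = i + 1" "k = i + 2"
  shows "phi powi k = phi powi j + phi powi i"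
proof -
  have "phi ^ 2 = phi + 1"
    by (simp add: phi_def power2_eq_square field_simps)
  then show ?thesis
    by (simp add: assms phi_powi_add algebra_simps)
qed

lemma phi_powi_mono: "i \<le> j \<Longrightarrow> phi powi i \<le> phi powi j"
  using phi_gt_1 by (simp add: power_int_increasing)

lemma phi_expands_zero: "phi_expands 0 (\<lambda>_. 0)"
  by (simp add: phi_expands_def)

lemma phi_expands_adjacent:
  assumes "phi_expands x d" "d i = 1"
  shows "d (i + 1) = 0" "d (i - 1) = 0"
proof -
  have "d i * d (i + 1) = 0" "d (i - 1) * d (i - 1 + 1) = 0"
    using assms(1) unfolding phi_expands_def by blast+
  then show "d (i + 1) = 0" "d (i - 1) = 0"
    using assms(2) by simp_all
qed

lemma phi_expands_digit: "phi_expands x d \<Longrightarrow> d i \<noteq> 0 \<Longrightarrow> d i = 1"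
  unfolding phi_expands_def by (metis insert_iff empty_iff)

lemma phi_expands_clear:
  assumes d: "phi_expands x d" and i: "d i = 1"
  shows "phi_expands (x - phi powi i) (d(i := 0))"
proof -
  have supp: "{j. (d(i := 0)) j \<noteq> 0} = {j. d j \<noteq> 0} - {i}"
    by auto
  have "(\<Sum>j\<in>{j. d j \<noteq> 0} - {i}. real ((d(i := 0)) j) * phi powi j)
      = (\<Sum>j\<in>{j. d j \<noteq> 0} - {i}. real (d j) * phi powi j)"
    by (rule sum.cong) auto
  also have "\<dots> = x - phi powi i"
    using d i by (simp add: phi_expands_def sum_diff1)
  finally show ?thesis
    using d unfolding phi_expands_def supp by simp
qed

lemma phi_expands_put:
  assumes d: "phi_expands x d" and "d i = 0" "d (i - 1) = 0" "d (i + 1) = 0"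
  shows "phi_expands (x + phi powi i) (d(i := 1))"
proof -
  have supp: "{j. (d(i := 1)) j \<noteq> 0} = insert i {j. d j \<noteq> 0}"
    by auto
  have "(\<Sum>j\<in>{j. d j \<noteq> 0}. real ((d(i := 1)) j) * phi powi j)
      = (\<Sum>j\<in>{j. d j \<noteq> 0}. real (d j) * phi powi j)"
    using assms(2) by (intro sum.cong) auto
  also have "\<dots> = x"
    using d by (simp add: phi_expands_def)
  finally have "(\<Sum>j\<in>insert i {j. d j \<noteq> 0}. real ((d(i := 1)) j) * phi powi j)
      = x + phi powi i"
    using d assms(2) by (simp add: phi_expands_def del: fun_upd_apply) simp
  moreover have "(d(i := 1)) j * (d(i := 1)) (j + 1) = 0" for j
  proof -
    have "d j * d (j + 1) = 0"
      using d unfolding phi_expands_def by blast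
    moreover have "j = i - 1" if "j + 1 = i"
      using that by simp
    ultimately show ?thesis
      using assms(3,4) by auto
  qed
  ultimately show ?thesis
    using d unfolding phi_expands_def supp by simp
qed

text \<open>
  Every expansion arises from the empty one by putting digits in increasing order; since ones are
  not adjacent, each new digit has an empty position directly below it.
\<close>

lemma phi_expands_induct [consumes 1, case_names zero put]:
  assumes "phi_expands x d"
    and zero: "P 0 (\<lambda>_. 0)"
    and put: "\<And>x d m. phi_expands x d \<Longrightarrow> P x d \<Longrightarrow> \<forall>j\<ge>m - 1. d j = 0 \<Longrightarrow>
      P (x + phi powi m) (d(m := 1))"
  shows "P x d"
  using assms(1)
proof (induction "card {i. d i \<noteq> 0}" arbitrary: x d)
  case 0
  then have "{i. d i \<noteq> 0} = {}"
    by (simp add: phi_expands_def)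
  moreover from this have "d = (\<lambda>_. 0)"
    by auto
  ultimately show ?case
    using zero 0 by (simp add: phi_expands_def)
next
  case (Suc c)
  have fin: "finite {i. d i \<noteq> 0}"
    using Suc.prems by (simp add: phi_expands_def)
  define m where "m = Max {i. d i \<noteq> 0}"
  have "{i. d i \<noteq> 0} \<noteq> {}"
    using Suc.hyps(2) by force
  then have "m \<in> {i. d i \<noteq> 0}"
    unfolding m_def using fin by (rule Max_in[rotated])
  then have m: "d m = 1"
    using phi_expands_digit[OF Suc.prems] by simp
  have max: "j \<le> m" if "d j \<noteq> 0" for j
    unfolding m_def using fin that by simp
  have e: "phi_expands (x - phi powi m) (d(m := 0))"
    using Suc.prems m by (rule phi_expands_clear)
  have "{i. (d(m := 0)) i \<noteq> 0} = {i. d i \<noteq> 0} - {m}"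
    by auto
  then have "card {i. (d(m := 0)) i \<noteq> 0} = c"
    using Suc.hyps(2) m by simp
  then have "P (x - phi powi m) (d(m := 0))"
    using Suc.hyps(1) e by simp
  moreover have "\<forall>j\<ge>m - 1. (d(m := 0)) j = 0"
  proof (intro allI impI)
    fix j assume "j \<ge> m - 1"
    then consider "j = m - 1" | "j = m" | "j > m"
      by linarith
    then show "(d(m := 0)) j = 0"
      using phi_expands_adjacent(2)[OF Suc.prems m] max[of j] by cases auto
  qed
  ultimately have "P (x - phi powi m + phi powi m) ((d(m := 0))(m := 1))"
    using put[OF e] by blast
  then show ?case
    using m by (metis diff_add_cancel fun_upd_triv fun_upd_upd)
qed

lemma phi_expands_nonneg: "phi_expands x d \<Longrightarrow> x \<ge> 0"
  by (simp add: phi_expands_def sum_nonneg less_imp_le[OF phi_powi_pos])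

lemma phi_expands_ge:
  assumes "phi_expands x d" "d i = 1"
  shows "x \<ge> phi powi i"
  using phi_expands_nonneg[OF phi_expands_clear[OF assms]] by simp

text \<open>
  By induction the digits below the greatest one, at \<open>m\<close>, are worth less than \<open>\<phi>\<^bsup>m-1\<^esup>\<close>, because
  position \<open>m - 1\<close> is empty, and \<open>\<phi>\<^bsup>m\<^esup> + \<phi>\<^bsup>m-1\<^esup> = \<phi>\<^bsup>m+1\<^esup>\<close>.
\<close>

lemma phi_expands_less:
  assumes "phi_expands x d" "\<forall>j\<ge>i. d j = 0"
  shows "x < phi powi i"
  using assms
proof (induction arbitrary: i rule: phi_expands_induct)
  case zero
  show ?case by (rule phi_powi_pos)
next
  case (put x d m)
  have "m < i"
    using put.prems by (metis fun_upd_same linorder_not_less zero_neq_one)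
  have "x + phi powi m < phi powi (m - 1) + phi powi m"
    using put.IH[OF put.hyps(2)] by simp
  also have "\<dots> = phi powi (m + 1)"
    using phi_powi_rec[of m "m - 1" "m + 1"] by simp
  also have "\<dots> \<le> phi powi i"
    using \<open>m < i\<close> by (intro phi_powi_mono) simp
  finally show ?case .
qed

text \<open>
  The bounds \<open>\<phi>\<^bsup>m\<^esup> \<le> x < \<phi>\<^bsup>m+1\<^esup>\<close> for an expansion of \<open>x\<close> with greatest digit at \<open>m\<close> force the
  same greatest digit in any other expansion of \<open>x\<close>; clearing it in both leads to the induction
  hypothesis.
\<close>

lemma phi_expands_unique:
  assumes "phi_expands x d" "phi_expands x d'"
  shows "d' = d"
  using assms
proof (induction arbitrary: d' rule: phi_expands_induct)
  case zero
  have "d' i = 0" for i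
    using phi_expands_ge[OF zero, of i] phi_powi_pos[of i] phi_expands_digit[OF zero, of i]
    by (cases "d' i = 0") auto
  then show ?case by auto
next
  case (put x d m)
  have "phi_expands (x + phi powi m) (d(m := 1))"
    using put.hyps by (intro phi_expands_put) auto
  then have less: "x + phi powi m < phi powi (m + 1)"
    using put.hyps(2) by (intro phi_expands_less) auto
  have above: "d' j = 0" if "j > m" for j
  proof (rule ccontr)
    assume "d' j \<noteq> 0"
    then have "phi powi j \<le> x + phi powi m"
      using phi_expands_ge phi_expands_digit put.prems by blast
    then show False
      using less phi_powi_mono[of "m + 1" j] that by simp
  qed
  have "d' m \<noteq> 0"
  proof
    assume "d' m = 0"
    then have "\<forall>j\<ge>m. d' j = 0"
      using above by (metis order_le_less)
    then show False
      using phi_expands_less[OF put.prems] phi_expands_nonneg[OF put.hyps(1)] by fastforce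
  qed
  then have m: "d' m = 1"
    using phi_expands_digit put.prems by blast
  then have "phi_expands x (d'(m := 0))"
    using phi_expands_clear[OF put.prems] by fastforce
  then have "d'(m := 0) = d"
    by (rule put.IH)
  then show ?case
    using m by (metis fun_upd_triv fun_upd_upd)
qed

lemma phi_digits_eqI:
  assumes "phi_expands (real N) d"
  shows "phi_digits N = d"
  unfolding phi_digits_def is_phi_expansion_iff
  using assms phi_expands_unique by blast

section \<open>Adding a Lucas number to an expansion\<close>

lemma lucas_powi:
  "real (lucas (2 * n)) = phi powi (2 * int n) + phi powi (- 2 * int n) \<and>
   real (lucas (2 * n + 1)) = phi powi (2 * int n + 1) - phi powi (- 2 * int n - 1)"
proof (induction n)
  case 0
  have "phi powi 1 = phi powi 0 + phi powi (- 1)"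
    by (rule phi_powi_rec) auto
  then show ?case by simp
next
  case (Suc n)
  have index: "2 * int (Suc n) = 2 * int n + 2" "- 2 * int (Suc n) = - 2 * int n - 2"
    "2 * int (Suc n) + 1 = 2 * int n + 3" "- 2 * int (Suc n) - 1 = - 2 * int n - 3"
    by simp_all
  have "phi powi (2 * int n + 2) = phi powi (2 * int n + 1) + phi powi (2 * int n)"
    "phi powi (- 2 * int n) = phi powi (- 2 * int n - 1) + phi powi (- 2 * int n - 2)"
    "phi powi (2 * int n + 3) = phi powi (2 * int n + 2) + phi powi (2 * int n + 1)"
    "phi powi (- 2 * int n - 1) = phi powi (- 2 * int n - 2) + phi powi (- 2 * int n - 3)"
    by (rule phi_powi_rec; simp)+
  moreover have "real (lucas (2 * Suc n)) = real (lucas (2 * n + 1)) + real (lucas (2 * n))"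
    "real (lucas (2 * Suc n + 1)) = 2 * real (lucas (2 * n + 1)) + real (lucas (2 * n))"
    by simp_all
  ultimately show ?case
    using Suc.IH unfolding index(3,4) unfolding index(1,2) by linarith
qed

lemma lucas_even: "real (lucas (2 * m + 2)) = phi powi (2 * int m + 2) + phi powi (- 2 * int m - 2)"
proof -
  have "2 * Suc m = 2 * m + 2" "2 * int (Suc m) = 2 * int m + 2"
    "- 2 * int (Suc m) = - 2 * int m - 2"
    by simp_all
  then show ?thesis
    using lucas_powi[of "Suc m"] by metis
qed

lemma lucas_odd: "real (lucas (2 * m + 3)) = phi powi (2 * int m + 3) - phi powi (- 2 * int m - 3)"
proof -
  have "2 * Suc m + 1 = 2 * m + 3" "2 * int (Suc m) + 1 = 2 * int m + 3"
    "- 2 * int (Suc m) - 1 = - 2 * int m - 3"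
    by simp_all
  then show ?thesis
    using lucas_powi[of "Suc m"] by metis
qed

definition spans :: "(int \<Rightarrow> nat) \<Rightarrow> int \<Rightarrow> int \<Rightarrow> bool" where
  "spans d l h \<longleftrightarrow> d l = 1 \<and> d h = 1 \<and> (\<forall>i. d i \<noteq> 0 \<longrightarrow> l \<le> i \<and> i \<le> h)"

lemma spans_outside: "spans d l h \<Longrightarrow> i < l \<or> h < i \<Longrightarrow> d i = 0"
  unfolding spans_def by (metis linorder_not_less)

lemma expands_even_step:
  assumes "phi_expands (real k) d" "\<forall>i. d i \<noteq> 0 \<longrightarrow> - 2 * int m \<le> i \<and> i \<le> 2 * int m"
  shows "phi_expands (real (lucas (2 * m + 2) + k))
           (d(2 * int m + 2 := 1, - 2 * int m - 2 := 1))"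
proof -
  have out: "d i = 0" if "i < - 2 * int m \<or> 2 * int m < i" for i
    using assms(2) that by (metis linorder_not_less)
  have "phi_expands (real k + phi powi (2 * int m + 2) + phi powi (- 2 * int m - 2))
           (d(2 * int m + 2 := 1, - 2 * int m - 2 := 1))"
    by (intro phi_expands_put assms(1)) (auto simp: out)
  moreover have "real (lucas (2 * m + 2) + k)
      = real k + phi powi (2 * int m + 2) + phi powi (- 2 * int m - 2)"
    using lucas_even[of m] by linarith
  ultimately show ?thesis by metis
qed

lemma spans_even_step:
  assumes "\<forall>i. d i \<noteq> 0 \<longrightarrow> - 2 * int m \<le> i \<and> i \<le> 2 * int m"
  shows "spans (d(2 * int m + 2 := 1, - 2 * int m - 2 := 1)) (- 2 * int m - 2) (2 * int m + 2)"
proof -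
  have "- 2 * int m - 2 \<le> i \<and> i \<le> 2 * int m + 2" if "d i \<noteq> 0" for i
    using assms that by (smt (verit))
  then show ?thesis
    by (auto simp: spans_def)
qed

text \<open>
  The shape for the numbers strictly between \<open>L\<^bsub>2m+1\<^esub>\<close> and \<open>L\<^bsub>2m+2\<^esub>\<close>. The condition on position
  \<open>- 2m\<close> says that the last three digits are \<open>001\<close>: it makes room for the one that \<open>step_I\<close> puts at
  \<open>- 2m - 1\<close>.
\<close>

definition odd_shape :: "nat \<Rightarrow> (int \<Rightarrow> nat) \<Rightarrow> bool" where
  "odd_shape m d \<longleftrightarrow> spans d (- 2 * int m - 2) (2 * int m + 1) \<and> d (- 2 * int m) = 0"

text \<open>
  The exchanges of outer blocks on \<open>I\<^sub>n\<close>, \<open>J\<^sub>n\<close> and \<open>K\<^sub>n\<close> for \<open>n = m + 1\<close>, as edits of digits. The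
  digits that become zero are cleared first, so that no edit ever creates adjacent ones.
\<close>

definition step_I :: "nat \<Rightarrow> (int \<Rightarrow> nat) \<Rightarrow> int \<Rightarrow> nat" where
  "step_I m d = d(- 2 * int m - 2 := 0, 2 * int m + 1 := 0,
     - 2 * int m - 1 := 1, - 2 * int m - 4 := 1, 2 * int m + 3 := 1)"

definition step_J :: "nat \<Rightarrow> (int \<Rightarrow> nat) \<Rightarrow> int \<Rightarrow> nat" where
  "step_J m d = d(- 2 * int m := 0, - 2 * int m - 1 := 1, - 2 * int m - 4 := 1,
     2 * int m + 3 := 1)"

definition step_K :: "nat \<Rightarrow> (int \<Rightarrow> nat) \<Rightarrow> int \<Rightarrow> nat" where
  "step_K m d = d(- 2 * int m - 2 := 0, - 2 * int m - 4 := 1, 2 * int m + 3 := 1)"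

lemma odd_shape_Suc_spans:
  assumes "odd_shape (Suc m) d"
  shows "spans d (- 2 * int m - 4) (2 * int m + 3)"
proof -
  have "- 2 * int (Suc m) - 2 = - 2 * int m - 4" "2 * int (Suc m) + 1 = 2 * int m + 3"
    by simp_all
  then show ?thesis
    using assms unfolding odd_shape_def by metis
qed

lemma odd_shape_adjacent:
  assumes "phi_expands x d" "odd_shape m d"
  shows "d (2 * int m) = 0" "d (- 2 * int m - 1) = 0"
proof -
  have "2 * int m = 2 * int m + 1 - 1" "- 2 * int m - 1 = - 2 * int m - 2 + 1"
    by simp_all
  moreover have "d (2 * int m + 1) = 1" "d (- 2 * int m - 2) = 1"
    using assms(2) by (auto simp: odd_shape_def spans_def)
  ultimately show "d (2 * int m) = 0" "d (- 2 * int m - 1) = 0"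
    using phi_expands_adjacent[OF assms(1)] by metis+
qed

text \<open>
  The value changes by \<open>(\<phi>\<^bsup>2m+3\<^esup> - \<phi>\<^bsup>2m+1\<^esup>) + (\<phi>\<^bsup>-2m-1\<^esup> - (\<phi>\<^bsup>-2m-2\<^esup> - \<phi>\<^bsup>-2m-4\<^esup>))\<close>, and the
  recurrence turns this into \<open>\<phi>\<^bsup>2m+2\<^esup> + (\<phi>\<^bsup>-2m-1\<^esup> - \<phi>\<^bsup>-2m-3\<^esup>) = \<phi>\<^bsup>2m+2\<^esup> + \<phi>\<^bsup>-2m-2\<^esup>\<close>.
\<close>

lemma expands_step_I:
  assumes "phi_expands (real N) d" "odd_shape m d"
  shows "phi_expands (real (N + lucas (2 * m + 2))) (step_I m d)"
proof -
  have s: "spans d (- 2 * int m - 2) (2 * int m + 1)" and z: "d (- 2 * int m) = 0"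
    using assms(2) by (auto simp: odd_shape_def)
  note out = spans_outside[OF s]
  have one: "d (- 2 * int m - 2) = 1" "d (2 * int m + 1) = 1"
    using s by (auto simp: spans_def)
  have "phi_expands (real N - phi powi (- 2 * int m - 2) - phi powi (2 * int m + 1)
      + phi powi (- 2 * int m - 1) + phi powi (- 2 * int m - 4) + phi powi (2 * int m + 3))
      (step_I m d)"
    unfolding step_I_def
    using one z odd_shape_adjacent[OF assms]
    by (intro phi_expands_put phi_expands_clear assms(1)) (auto simp: out)
  moreover have
    "phi powi (2 * int m + 3) = phi powi (2 * int m + 2) + phi powi (2 * int m + 1)"
    "phi powi (- 2 * int m - 1) = phi powi (- 2 * int m - 2) + phi powi (- 2 * int m - 3)"
    "phi powi (- 2 * int m - 2) = phi powi (- 2 * int m - 3) + phi powi (- 2 * int m - 4)"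
    by (rule phi_powi_rec; simp)+
  then have "real (N + lucas (2 * m + 2)) =
      real N - phi powi (- 2 * int m - 2) - phi powi (2 * int m + 1)
      + phi powi (- 2 * int m - 1) + phi powi (- 2 * int m - 4) + phi powi (2 * int m + 3)"
    using lucas_even[of m] by linarith
  ultimately show ?thesis by metis
qed

lemma expands_step_K:
  assumes "phi_expands (real N) d" "odd_shape m d"
  shows "phi_expands (real (N + lucas (2 * m + 3))) (step_K m d)"
proof -
  have s: "spans d (- 2 * int m - 2) (2 * int m + 1)"
    using assms(2) by (auto simp: odd_shape_def)
  note out = spans_outside[OF s]
  have one: "d (- 2 * int m - 2) = 1"
    using s by (auto simp: spans_def)
  have "phi_expands (real N - phi powi (- 2 * int m - 2)
      + phi powi (- 2 * int m - 4) + phi powi (2 * int m + 3)) (step_K m d)"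
    unfolding step_K_def
    using one odd_shape_adjacent[OF assms]
    by (intro phi_expands_put phi_expands_clear assms(1)) (auto simp: out)
  moreover have
    "phi powi (- 2 * int m - 2) = phi powi (- 2 * int m - 3) + phi powi (- 2 * int m - 4)"
    by (rule phi_powi_rec; simp)
  then have "real (N + lucas (2 * m + 3)) = real N - phi powi (- 2 * int m - 2)
      + phi powi (- 2 * int m - 4) + phi powi (2 * int m + 3)"
    using lucas_odd[of m] by linarith
  ultimately show ?thesis by metis
qed

text \<open>
  The one at \<open>- 2m\<close> is split into \<open>\<phi>\<^bsup>-2m-1\<^esup> + \<phi>\<^bsup>-2m-2\<^esup>\<close>, and then
  \<open>\<phi>\<^bsup>-2m-2\<^esup>\<close> is lowered to \<open>\<phi>\<^bsup>-2m-4\<^esup>\<close>, which loses the \<open>\<phi>\<^bsup>-2m-3\<^esup>\<close> that \<open>L\<^bsub>2m+3\<^esub>\<close> falls short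
  of \<open>\<phi>\<^bsup>2m+3\<^esup>\<close>.
\<close>

lemma expands_step_J:
  assumes "phi_expands (real N) d" "spans d (- 2 * int m) (2 * int m)"
  shows "phi_expands (real (N + lucas (2 * m + 3))) (step_J m d)"
proof -
  note out = spans_outside[OF assms(2)]
  have one: "d (- 2 * int m) = 1"
    using assms(2) by (auto simp: spans_def)
  have "phi_expands (real N - phi powi (- 2 * int m) + phi powi (- 2 * int m - 1)
      + phi powi (- 2 * int m - 4) + phi powi (2 * int m + 3)) (step_J m d)"
    unfolding step_J_def
    using one
    by (intro phi_expands_put phi_expands_clear assms(1)) (auto simp: out)
  moreover have
    "phi powi (- 2 * int m) = phi powi (- 2 * int m - 1) + phi powi (- 2 * int m - 2)"
    "phi powi (- 2 * int m - 2) = phi powi (- 2 * int m - 3) + phi powi (- 2 * int m - 4)"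
    by (rule phi_powi_rec; simp)+
  then have "real (N + lucas (2 * m + 3)) = real N - phi powi (- 2 * int m)
      + phi powi (- 2 * int m - 1) + phi powi (- 2 * int m - 4) + phi powi (2 * int m + 3)"
    using lucas_odd[of m] by linarith
  ultimately show ?thesis by metis
qed

lemma odd_shapeI:
  assumes "d (- 2 * int m - 2) = 1" "d (2 * int m + 1) = 1" "d (- 2 * int m) = 0"
    "\<And>i. i < - 2 * int m - 2 \<or> 2 * int m + 1 < i \<Longrightarrow> d i = 0"
  shows "odd_shape m d"
  unfolding odd_shape_def spans_def using assms by (meson linorder_not_less)

lemma odd_shape_step:
  assumes "odd_shape m d"
  shows odd_shape_step_I: "odd_shape (Suc m) (step_I m d)"
    and odd_shape_step_K: "odd_shape (Suc m) (step_K m d)"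
proof -
  have s: "spans d (- 2 * int m - 2) (2 * int m + 1)" and z: "d (- 2 * int m) = 0"
    using assms by (auto simp: odd_shape_def)
  note out = spans_outside[OF s]
  show "odd_shape (Suc m) (step_I m d)"
    using z by (intro odd_shapeI) (auto simp: step_I_def out)
  show "odd_shape (Suc m) (step_K m d)"
    using z by (intro odd_shapeI) (auto simp: step_K_def out)
qed

lemma odd_shape_step_J:
  assumes "spans d (- 2 * int m) (2 * int m)"
  shows "odd_shape (Suc m) (step_J m d)"
proof -
  note out = spans_outside[OF assms]
  show ?thesis
    by (intro odd_shapeI) (auto simp: step_J_def out)
qed

section \<open>The shape of the expansions\<close>

text \<open>
  The bounds \<open>l \<le> 0 \<le> h\<close> place the radix point inside the word of \<open>k\<close>, as needed for the
  word form of Part I.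
\<close>

definition shape_upto_odd :: "nat \<Rightarrow> bool" where
  "shape_upto_odd m \<longleftrightarrow> (\<forall>k. 1 \<le> k \<and> k \<le> lucas (2 * m + 1) \<longrightarrow>
     phi_expands (real k) (phi_digits k) \<and>
     (\<exists>l h. spans (phi_digits k) l h \<and> - 2 * int m \<le> l \<and> l \<le> 0 \<and> 0 \<le> h \<and> h \<le> 2 * int m))"

definition shape_odd :: "nat \<Rightarrow> bool" where
  "shape_odd m \<longleftrightarrow> (\<forall>N. lucas (2 * m + 1) < N \<and> N < lucas (2 * m + 2) \<longrightarrow>
     phi_expands (real N) (phi_digits N) \<and> odd_shape m (phi_digits N))"

definition shape_even :: "nat \<Rightarrow> bool" where
  "shape_even m \<longleftrightarrow> (\<forall>N. lucas (2 * m) \<le> N \<and> N \<le> lucas (2 * m + 1) \<longrightarrow>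
     phi_expands (real N) (phi_digits N) \<and> spans (phi_digits N) (- 2 * int m) (2 * int m))"

lemma lucas_rec:
  "lucas (2 * m + 2) = lucas (2 * m + 1) + lucas (2 * m)"
  "lucas (2 * m + 3) = lucas (2 * m + 2) + lucas (2 * m + 1)"
  "lucas (2 * m + 4) = lucas (2 * m + 3) + lucas (2 * m + 2)"
  by (simp_all add: eval_nat_numeral)

lemma index_Suc:
  "2 * Suc m = 2 * m + 2" "2 * m + 2 + 1 = 2 * m + 3" "2 * m + 2 + 2 = 2 * m + 4"
  "2 * int (Suc m) = 2 * int m + 2" "- 2 * int (Suc m) = - 2 * int m - 2"
  by simp_all

lemma phi_digits_eq:
  assumes "phi_expands (real N) d"
  shows "phi_digits N = d" "phi_expands (real N) (phi_digits N)"
  using assms phi_digits_eqI by simp_all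

lemma shape_even_Suc:
  assumes "shape_upto_odd m"
  shows "shape_even (Suc m)"
  unfolding shape_even_def index_Suc
proof (intro allI impI)
  fix N assume N: "lucas (2 * m + 2) \<le> N \<and> N \<le> lucas (2 * m + 3)"
  define k where "k = N - lucas (2 * m + 2)"
  have k: "k \<le> lucas (2 * m + 1)" "N = lucas (2 * m + 2) + k"
    using N lucas_rec(2)[of m] by (auto simp: k_def)
  \<comment> \<open>The left end of the range is \<open>k = 0\<close>, which has the empty expansion.\<close>
  have "\<exists>d. phi_expands (real k) d \<and> (\<forall>i. d i \<noteq> 0 \<longrightarrow> - 2 * int m \<le> i \<and> i \<le> 2 * int m)"
  proof (cases "k = 0")
    case True
    then show ?thesis
      using phi_expands_zero by auto
  next
    case False
    then obtain l h where "phi_expands (real k) (phi_digits k)" "spans (phi_digits k) l h"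
      "- 2 * int m \<le> l" "h \<le> 2 * int m"
      using assms k(1) unfolding shape_upto_odd_def by (metis One_nat_def Suc_leI neq0_conv)
    then show ?thesis
      unfolding spans_def by (meson order_trans)
  qed
  then obtain d where d: "phi_expands (real k) d"
    "\<forall>i. d i \<noteq> 0 \<longrightarrow> - 2 * int m \<le> i \<and> i \<le> 2 * int m"
    by blast
  show "phi_expands (real N) (phi_digits N) \<and>
      spans (phi_digits N) (- 2 * int m - 2) (2 * int m + 2)"
    using phi_digits_eq[OF expands_even_step[OF d]] spans_even_step[OF d(2)] k(2) by metis
qed

text \<open>
  The three intervals \<open>I\<^sub>n\<close>, \<open>J\<^sub>n\<close>, \<open>K\<^sub>n\<close> with \<open>n = m + 1\<close> cover the range. Their elements arise
  from the odd range of index \<open>m\<close> (for \<open>I\<^sub>n\<close> and \<open>K\<^sub>n\<close>) and from the even range of index \<open>m\<close>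
  (for \<open>J\<^sub>n\<close>). For \<open>m = 0\<close> the even range \<open>[L\<^sub>0, L\<^sub>1] = [2, 1]\<close> is empty.
\<close>

lemma shape_odd_Suc:
  assumes odd: "shape_odd m" and even: "m \<ge> 1 \<Longrightarrow> shape_even m"
  shows "shape_odd (Suc m)"
  unfolding shape_odd_def index_Suc
proof (intro allI impI)
  fix N assume N: "lucas (2 * m + 3) < N \<and> N < lucas (2 * m + 4)"
  note rec = lucas_rec[of m]
  consider (I) "N < lucas (2 * m + 3) + lucas (2 * m)"
    | (J) "lucas (2 * m + 3) + lucas (2 * m) \<le> N" "N \<le> lucas (2 * m + 3) + lucas (2 * m + 1)"
    | (K) "lucas (2 * m + 3) + lucas (2 * m + 1) < N"
    by linarith
  then obtain d where "phi_expands (real N) d" "odd_shape (Suc m) d"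
  proof cases
    case I
    define M where "M = N - lucas (2 * m + 2)"
    have M: "lucas (2 * m + 1) < M" "M < lucas (2 * m + 2)" "N = M + lucas (2 * m + 2)"
      using I N rec by (auto simp: M_def)
    then have "phi_expands (real M) (phi_digits M)" "odd_shape m (phi_digits M)"
      using odd unfolding shape_odd_def by auto
    then show ?thesis
      using that expands_step_I odd_shape_step_I M(3) by blast
  next
    case J
    define M where "M = N - lucas (2 * m + 3)"
    have M: "lucas (2 * m) \<le> M" "M \<le> lucas (2 * m + 1)" "N = M + lucas (2 * m + 3)"
      using J by (auto simp: M_def)
    have m: "m \<ge> 1"
      using M(1,2) by (cases m) auto
    have "phi_expands (real M) (phi_digits M)" "spans (phi_digits M) (- 2 * int m) (2 * int m)"
      using even[OF m] M unfolding shape_even_def by auto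
    then show ?thesis
      using that expands_step_J odd_shape_step_J M(3) by blast
  next
    case K
    define M where "M = N - lucas (2 * m + 3)"
    have M: "lucas (2 * m + 1) < M" "M < lucas (2 * m + 2)" "N = M + lucas (2 * m + 3)"
      using K N rec by (auto simp: M_def)
    then have "phi_expands (real M) (phi_digits M)" "odd_shape m (phi_digits M)"
      using odd unfolding shape_odd_def by auto
    then show ?thesis
      using that expands_step_K odd_shape_step_K M(3) by blast
  qed
  then show "phi_expands (real N) (phi_digits N) \<and> odd_shape (Suc m) (phi_digits N)"
    using phi_digits_eq by metis
qed

lemma shape_upto_odd_Suc:
  assumes upto: "shape_upto_odd m" and odd: "shape_odd m"
  shows "shape_upto_odd (Suc m)"
  unfolding shape_upto_odd_def index_Suc
proof (intro allI impI)
  fix k assume k: "1 \<le> k \<and> k \<le> lucas (2 * m + 3)"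
  let ?P = "phi_expands (real k) (phi_digits k) \<and> (\<exists>l h. spans (phi_digits k) l h \<and>
    - 2 * int m - 2 \<le> l \<and> l \<le> 0 \<and> 0 \<le> h \<and> h \<le> 2 * int m + 2)"
  consider "k \<le> lucas (2 * m + 1)" | "lucas (2 * m + 1) < k" "k < lucas (2 * m + 2)"
    | "lucas (2 * m + 2) \<le> k"
    by linarith
  then show ?P
  proof cases
    case 1
    then show ?thesis
      using upto k unfolding shape_upto_odd_def by fastforce
  next
    case 2
    then show ?thesis
      using odd unfolding shape_odd_def odd_shape_def by fastforce
  next
    case 3
    then show ?thesis
      using shape_even_Suc[OF upto] k unfolding shape_even_def index_Suc by fastforce
  qed
qed

text \<open>
  The odd range of index \<open>0\<close> consists of \<open>2 = \<phi> + \<phi>\<^bsup>-2\<^esup>\<close> alone.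
\<close>

lemma shape_base: "shape_upto_odd 0" "shape_odd 0"
proof -
  have one: "phi_expands (real 1) ((\<lambda>_. 0)(0 := 1))"
    using phi_expands_put[OF phi_expands_zero, of 0] by simp
  then show "shape_upto_odd 0"
    using phi_digits_eq[OF one]
    by (auto simp: shape_upto_odd_def spans_def dest!: le_antisym)
  have "phi_expands (0 + phi powi 1 + phi powi (- 2)) ((\<lambda>_. 0)(1 := 1, - 2 := 1))"
    by (intro phi_expands_put phi_expands_zero) auto
  moreover have "phi powi 1 = phi powi 0 + phi powi (- 1)"
    "phi powi 0 = phi powi (- 1) + phi powi (- 2)"
    by (rule phi_powi_rec; simp)+
  then have "real 2 = 0 + phi powi 1 + phi powi (- 2)"
    by simp
  ultimately have two: "phi_expands (real 2) ((\<lambda>_. 0)(1 := 1, - 2 := 1))"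
    by metis
  have "N = 2" if "lucas (2 * 0 + 1) < N \<and> N < lucas (2 * 0 + 2)" for N
    using that by (simp add: numeral_2_eq_2)
  moreover have "odd_shape 0 ((\<lambda>_. 0)(1 := 1, - 2 := 1))"
    by (rule odd_shapeI) auto
  ultimately show "shape_odd 0"
    using phi_digits_eq[OF two] unfolding shape_odd_def by metis
qed

lemma shapes: "shape_upto_odd m \<and> shape_odd m \<and> (m \<ge> 1 \<longrightarrow> shape_even m)"
  by (induction m) (auto simp: shape_base intro: shape_upto_odd_Suc shape_odd_Suc shape_even_Suc)

section \<open>Words\<close>

text \<open>
  The positions \<open>l\<close> and \<open>h\<close> are free, so that \<open>digit_word\<close> also denotes the inner part of a
  word, on which the two sides of Part II agree.
\<close>

definition digit_word :: "(int \<Rightarrow> nat) \<Rightarrow> int \<Rightarrow> int \<Rightarrow> letter list" where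
  "digit_word d l h =
     map (digit_letter \<circ> d) (rev [0..h]) @ [Point] @ map (digit_letter \<circ> d) (rev [l..-1])"

lemma spans_positions:
  assumes "spans (phi_digits N) l h"
  shows spans_high_pos: "high_pos N = h" and spans_low_pos: "low_pos N = l"
proof -
  have "{i. phi_digits N i \<noteq> 0} \<subseteq> {l..h}"
    using assms by (auto simp: spans_def)
  then have "finite {i. phi_digits N i \<noteq> 0}"
    using finite_subset by blast
  then show "high_pos N = h" "low_pos N = l"
    using assms unfolding high_pos_def low_pos_def spans_def
    by (intro Max_eqI Min_eqI; auto)+
qed

lemma beta_eq_digit_word:
  "spans (phi_digits N) l h \<Longrightarrow> beta N = digit_word (phi_digits N) l h"
  by (simp add: beta_def digit_word_def spans_high_pos spans_low_pos)

lemma digit_word_cong: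
  assumes "\<And>i. l \<le> i \<Longrightarrow> i \<le> h \<Longrightarrow> d i = d' i" "l \<le> 0" "- 1 \<le> h"
  shows "digit_word d l h = digit_word d' l h"
  using assms by (auto simp: digit_word_def)

text \<open>
  The case \<open>h = - 1\<close> or \<open>l = 0\<close> is the one in which nothing remains on that side of the radix
  point.
\<close>

lemma digit_word_split:
  assumes "l' \<le> l" "l \<le> 0" "- 1 \<le> h" "h \<le> h'"
  shows "digit_word d l' h' = map (digit_letter \<circ> d) (rev [h + 1..h']) @ digit_word d l h @
    map (digit_letter \<circ> d) (rev [l'..l - 1])"
proof -
  have "[0..h'] = [0..h] @ [h + 1..h']"
    using assms upto_split2[of 0 h h'] by (cases "h = - 1") auto
  moreover have "[l'..-1] = [l'..l - 1] @ [l..-1]"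
    using assms upto_split1[of l' l "- 1"] by (cases "l = 0") auto
  ultimately show ?thesis
    by (simp add: digit_word_def)
qed

text \<open>
  This is the only computation in the free group: the inverse words cancel a genuine prefix
  and a genuine suffix.
\<close>

lemma word_exchange:
  "word p' * inverse (word p) * word (p @ w @ s) * inverse (word s) * word s' = word (p' @ w @ s')"
proof -
  have "word p' * inverse (word p) * word (p @ w @ s) * inverse (word s) * word s'
      = word p' * (inverse (word p) * word p) * word w * (word s * inverse (word s)) * word s'"
    by (simp only: word_append mult.assoc)
  then show ?thesis
    by (simp only: free_group_left_inverse free_group_right_inverse word_append mult.assoc
        mult_1_left mult_1_right)
qed

text \<open>
  The inner word is the same in all three lines, as the two steps edit only positions outside
  \<open>[- 2m, 2m - 1]\<close>. For \<open>m = 0\<close> it is the radix point alone.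
\<close>

lemma digit_word_odd:
  assumes "phi_expands x d" "odd_shape m d"
  shows "digit_word d (- 2 * int m - 2) (2 * int m + 1)
      = [One, Zero] @ digit_word d (- 2 * int m) (2 * int m - 1) @ [Zero, One]"
    and "digit_word (step_I m d) (- 2 * int m - 4) (2 * int m + 3)
      = [One, Zero, Zero, Zero] @ digit_word d (- 2 * int m) (2 * int m - 1) @
        [One, Zero, Zero, One]"
    and "digit_word (step_K m d) (- 2 * int m - 4) (2 * int m + 3)
      = [One, Zero, One, Zero] @ digit_word d (- 2 * int m) (2 * int m - 1) @
        [Zero, Zero, Zero, One]"
proof -
  have s: "spans d (- 2 * int m - 2) (2 * int m + 1)"
    using assms(2) by (simp add: odd_shape_def)
  note out = spans_outside[OF s]
  note adj = odd_shape_adjacent[OF assms(1,2)]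
  have one: "d (- 2 * int m - 2) = 1" "d (2 * int m + 1) = 1"
    using s by (simp_all add: spans_def)
  have top: "[2 * int m - 1 + 1..2 * int m + 1] = [2 * int m, 2 * int m + 1]"
    "[2 * int m - 1 + 1..2 * int m + 3] = [2 * int m, 2 * int m + 1, 2 * int m + 2, 2 * int m + 3]"
    by (simp_all add: upto_rec1)
  have bot: "[- 2 * int m - 2..- 2 * int m - 1] = [- 2 * int m - 2, - 2 * int m - 1]"
    "[- 2 * int m - 4..- 2 * int m - 1]
      = [- 2 * int m - 4, - 2 * int m - 3, - 2 * int m - 2, - 2 * int m - 1]"
    by (simp_all add: upto_rec1)
  note split = digit_word_split[where l = "- 2 * int m" and h = "2 * int m - 1"]
  show "digit_word d (- 2 * int m - 2) (2 * int m + 1)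
      = [One, Zero] @ digit_word d (- 2 * int m) (2 * int m - 1) @ [Zero, One]"
    using adj one
    by (subst split; (simp only: top bot)?) (auto simp: digit_letter_def)
  have "digit_word (step_I m d) (- 2 * int m) (2 * int m - 1)
      = digit_word d (- 2 * int m) (2 * int m - 1)"
    by (intro digit_word_cong) (auto simp: step_I_def)
  then show "digit_word (step_I m d) (- 2 * int m - 4) (2 * int m + 3)
      = [One, Zero, Zero, Zero] @ digit_word d (- 2 * int m) (2 * int m - 1) @
        [One, Zero, Zero, One]"
    using adj one
    by (subst split; (simp only: top bot)?) (auto simp: digit_letter_def step_I_def out)
  have "digit_word (step_K m d) (- 2 * int m) (2 * int m - 1)
      = digit_word d (- 2 * int m) (2 * int m - 1)"
    by (intro digit_word_cong) (auto simp: step_K_def)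
  then show "digit_word (step_K m d) (- 2 * int m - 4) (2 * int m + 3)
      = [One, Zero, One, Zero] @ digit_word d (- 2 * int m) (2 * int m - 1) @
        [Zero, Zero, Zero, One]"
    using adj one
    by (subst split; (simp only: top bot)?) (auto simp: digit_letter_def step_K_def out)
qed

lemma digit_word_even:
  assumes "phi_expands x d" "spans d (- 2 * int m) (2 * int m)" "m \<ge> 1"
  shows "digit_word d (- 2 * int m) (2 * int m)
      = [One, Zero] @ digit_word d (- 2 * int m + 2) (2 * int m - 2) @ [Zero, One]"
    and "digit_word (step_J m d) (- 2 * int m - 4) (2 * int m + 3)
      = [One, Zero, Zero, One, Zero] @ digit_word d (- 2 * int m + 2) (2 * int m - 2) @
        [Zero, Zero, One, Zero, Zero, One]"
proof -
  note out = spans_outside[OF assms(2)]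
  have one: "d (- 2 * int m) = 1" "d (2 * int m) = 1"
    using assms(2) by (simp_all add: spans_def)
  have adj: "d (- 2 * int m + 1) = 0" "d (2 * int m - 1) = 0"
    using phi_expands_adjacent[OF assms(1)] one by blast+
  have top: "[2 * int m - 2 + 1..2 * int m] = [2 * int m - 1, 2 * int m]"
    "[2 * int m - 2 + 1..2 * int m + 3]
      = [2 * int m - 1, 2 * int m, 2 * int m + 1, 2 * int m + 2, 2 * int m + 3]"
    by (simp_all add: upto_rec1)
  have bot: "[- 2 * int m..- 2 * int m + 2 - 1] = [- 2 * int m, - 2 * int m + 1]"
    "[- 2 * int m - 4..- 2 * int m + 2 - 1] = [- 2 * int m - 4, - 2 * int m - 3,
      - 2 * int m - 2, - 2 * int m - 1, - 2 * int m, - 2 * int m + 1]"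
    by (simp_all add: upto_rec1)
  note split = digit_word_split[where l = "- 2 * int m + 2" and h = "2 * int m - 2"]
  show "digit_word d (- 2 * int m) (2 * int m)
      = [One, Zero] @ digit_word d (- 2 * int m + 2) (2 * int m - 2) @ [Zero, One]"
    using adj one assms(3)
    by (subst split; (simp only: top bot)?) (auto simp: digit_letter_def)
  have "digit_word (step_J m d) (- 2 * int m + 2) (2 * int m - 2)
      = digit_word d (- 2 * int m + 2) (2 * int m - 2)"
    using assms(3) by (intro digit_word_cong) (auto simp: step_J_def)
  then show "digit_word (step_J m d) (- 2 * int m - 4) (2 * int m + 3)
      = [One, Zero, Zero, One, Zero] @ digit_word d (- 2 * int m + 2) (2 * int m - 2) @
        [Zero, Zero, One, Zero, Zero, One]"
    using adj one assms(3)
    by (subst split; (simp only: top bot)?) (auto simp: digit_letter_def step_J_def out)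
qed

lemma map_digits_zero:
  assumes "\<And>i. a \<le> i \<Longrightarrow> i \<le> b \<Longrightarrow> d i = 0"
  shows "map (digit_letter \<circ> d) (rev [a..b]) = replicate (nat (b - a + 1)) Zero"
proof -
  have "map (digit_letter \<circ> d) (rev [a..b]) = map (\<lambda>_. Zero) (rev [a..b])"
    using assms by (intro map_cong) (auto simp: digit_letter_def)
  then show ?thesis
    by (simp add: map_replicate_const)
qed

section \<open>The recursion\<close>

lemma beta_even:
  assumes "1 \<le> k" "k \<le> lucas (2 * m + 1)"
  shows "phi_digits (lucas (2 * m + 2) + k)
      = (\<lambda>i. phi_digits (lucas (2 * m + 2)) i + phi_digits k i)"
    and "high_pos k < 2 * int m + 2" "- 2 * int m - 2 < low_pos k"
    and "beta (lucas (2 * m + 2) + k)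
      = [One] @ replicate (nat (2 * int m + 2 - 1 - high_pos k)) Zero @ beta k @
        replicate (nat (low_pos k - 1 + (2 * int m + 2))) Zero @ [One]"
proof -
  define d where "d = phi_digits k"
  define e where "e = d(2 * int m + 2 := 1, - 2 * int m - 2 := 1)"
  obtain l h where d: "phi_expands (real k) d" and s: "spans d l h"
    and lh: "- 2 * int m \<le> l" "l \<le> 0" "0 \<le> h" "h \<le> 2 * int m"
    using shapes[of m] assms unfolding shape_upto_odd_def d_def by blast
  note out = spans_outside[OF s]
  have supp: "\<forall>i. d i \<noteq> 0 \<longrightarrow> - 2 * int m \<le> i \<and> i \<le> 2 * int m"
    using s lh unfolding spans_def by (meson order_trans)
  have pos: "high_pos k = h" "low_pos k = l"
    using s by (simp_all add: d_def spans_high_pos spans_low_pos)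
  show "high_pos k < 2 * int m + 2" "- 2 * int m - 2 < low_pos k"
    using pos lh by simp_all
  have sum: "phi_digits (lucas (2 * m + 2) + k) = e"
    using phi_digits_eqI[OF expands_even_step[OF d supp]] by (simp only: e_def)
  have "phi_expands (real (lucas (2 * m + 2) + 0))
      ((\<lambda>_. 0)(2 * int m + 2 := 1, - 2 * int m - 2 := 1))"
    by (rule expands_even_step) (simp_all add: phi_expands_zero)
  then have "phi_digits (lucas (2 * m + 2)) = (\<lambda>_. 0)(2 * int m + 2 := 1, - 2 * int m - 2 := 1)"
    using phi_digits_eqI by (metis add_0_right)
  then show "phi_digits (lucas (2 * m + 2) + k)
      = (\<lambda>i. phi_digits (lucas (2 * m + 2)) i + phi_digits k i)"
    using sum lh by (auto simp: e_def d_def[symmetric] out simp del: lucas.simps)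
  have "spans e (- 2 * int m - 2) (2 * int m + 2)"
    unfolding e_def using supp by (rule spans_even_step)
  then have "beta (lucas (2 * m + 2) + k) = digit_word e (- 2 * int m - 2) (2 * int m + 2)"
    using beta_eq_digit_word sum by metis
  also have "\<dots> = map (digit_letter \<circ> e) (rev [2 * int m + 1 + 1..2 * int m + 2]) @
      digit_word e (- 2 * int m - 1) (2 * int m + 1) @
      map (digit_letter \<circ> e) (rev [- 2 * int m - 2..- 2 * int m - 1 - 1])"
    by (rule digit_word_split) simp_all
  also have "\<dots> = [One] @ digit_word e (- 2 * int m - 1) (2 * int m + 1) @ [One]"
    by (simp add: upto_rec1 e_def digit_letter_def)
  also have "digit_word e (- 2 * int m - 1) (2 * int m + 1)
      = digit_word d (- 2 * int m - 1) (2 * int m + 1)"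
    by (rule digit_word_cong) (auto simp: e_def)
  also have "\<dots> = map (digit_letter \<circ> d) (rev [h + 1..2 * int m + 1]) @ digit_word d l h @
      map (digit_letter \<circ> d) (rev [- 2 * int m - 1..l - 1])"
    using lh by (intro digit_word_split) simp_all
  also have "\<dots> = replicate (nat (2 * int m + 2 - 1 - h)) Zero @ beta k @
      replicate (nat (l - 1 + (2 * int m + 2))) Zero"
    using beta_eq_digit_word[of k l h] s
    by (simp add: map_digits_zero out d_def[symmetric] algebra_simps)
  finally show "beta (lucas (2 * m + 2) + k)
      = [One] @ replicate (nat (2 * int m + 2 - 1 - high_pos k)) Zero @ beta k @
        replicate (nat (low_pos k - 1 + (2 * int m + 2))) Zero @ [One]"
    unfolding pos by simp
qed

lemma beta_steps_I_K:
  assumes "lucas (2 * m + 1) < M" "M < lucas (2 * m + 2)"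
  shows "word (beta (M + lucas (2 * m + 2)))
      = word [One, Zero, Zero, Zero] * inverse (word [One, Zero]) * word (beta M) *
        inverse (word [Zero, One]) * word [One, Zero, Zero, One]"
    and "word (beta (M + lucas (2 * m + 3)))
      = word [One, Zero, One, Zero] * inverse (word [One, Zero]) * word (beta M) *
        inverse (word [Zero, One]) * word [Zero, Zero, Zero, One]"
proof -
  define d where "d = phi_digits M"
  have d: "phi_expands (real M) d" "odd_shape m d"
    using shapes[of m] assms unfolding shape_odd_def d_def by blast+
  have new: "beta N = digit_word e (- 2 * int m - 4) (2 * int m + 3)"
    if "phi_expands (real N) e" "odd_shape (Suc m) e" for N e
  proof -
    have "spans e (- 2 * int m - 4) (2 * int m + 3)"
      using that(2) by (rule odd_shape_Suc_spans)
    then show ?thesis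
      using phi_digits_eqI[OF that(1)] beta_eq_digit_word by metis
  qed
  have "beta M = digit_word d (- 2 * int m - 2) (2 * int m + 1)"
    using d(2) unfolding d_def odd_shape_def by (intro beta_eq_digit_word) simp
  then have M: "beta M
      = [One, Zero] @ digit_word d (- 2 * int m) (2 * int m - 1) @ [Zero, One]"
    using digit_word_odd(1)[OF d] by simp
  show "word (beta (M + lucas (2 * m + 2)))
      = word [One, Zero, Zero, Zero] * inverse (word [One, Zero]) * word (beta M) *
        inverse (word [Zero, One]) * word [One, Zero, Zero, One]"
    unfolding M new[OF expands_step_I[OF d] odd_shape_step_I[OF d(2)]]
      digit_word_odd(2)[OF d] word_exchange ..
  show "word (beta (M + lucas (2 * m + 3)))
      = word [One, Zero, One, Zero] * inverse (word [One, Zero]) * word (beta M) *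
        inverse (word [Zero, One]) * word [Zero, Zero, Zero, One]"
    unfolding M new[OF expands_step_K[OF d] odd_shape_step_K[OF d(2)]]
      digit_word_odd(3)[OF d] word_exchange ..
qed

lemma beta_step_J:
  assumes "m \<ge> 1" "lucas (2 * m) \<le> M" "M \<le> lucas (2 * m + 1)"
  shows "word (beta (M + lucas (2 * m + 3)))
      = word [One, Zero, Zero, One, Zero] * inverse (word [One, Zero]) * word (beta M) *
        inverse (word [Zero, One]) * word [Zero, Zero, One, Zero, Zero, One]"
proof -
  define d where "d = phi_digits M"
  have d: "phi_expands (real M) d" "spans d (- 2 * int m) (2 * int m)"
    using shapes[of m] assms unfolding shape_even_def d_def by blast+
  have "spans (step_J m d) (- 2 * int m - 4) (2 * int m + 3)"
    using odd_shape_step_J[OF d(2)] by (rule odd_shape_Suc_spans)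
  then have N: "beta (M + lucas (2 * m + 3))
      = digit_word (step_J m d) (- 2 * int m - 4) (2 * int m + 3)"
    using phi_digits_eqI[OF expands_step_J[OF d]] beta_eq_digit_word by metis
  have "beta M = digit_word d (- 2 * int m) (2 * int m)"
    using d(2) unfolding d_def by (rule beta_eq_digit_word)
  then have M: "beta M
      = [One, Zero] @ digit_word d (- 2 * int m + 2) (2 * int m - 2) @ [Zero, One]"
    using digit_word_even(1)[OF d assms(1)] by simp
  show ?thesis
    unfolding M N digit_word_even(2)[OF d assms(1)] word_exchange ..
qed

theorem mainTheorem1:
  shows
    "(\<forall>n\<ge>1. \<forall>k\<in>{1..lucas (2*n-1)}.
        phi_digits (lucas (2*n) + k) = (\<lambda>i. phi_digits (lucas (2*n)) i + phi_digits k i) \<and>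
        high_pos k < 2 * int n \<and> - 2 * int n < low_pos k \<and>
        beta (lucas (2*n) + k) =
          [One] @ replicate (nat (2 * int n - 1 - high_pos k)) Zero @ beta k @
          replicate (nat (low_pos k - 1 + 2 * int n)) Zero @ [One]) \<and>
     (\<forall>n\<ge>2. \<forall>k\<in>{1..lucas (2*n-2) - 1}.
        word (beta (lucas (2*n+1) + k)) =
          word [One, Zero, Zero, Zero] * inverse (word [One, Zero]) *
          word (beta (lucas (2*n-1) + k)) *
          inverse (word [Zero, One]) * word [One, Zero, Zero, One] \<and>
        word (beta (lucas (2*n+1) + lucas (2*n-1) + k)) =
          word [One, Zero, One, Zero] * inverse (word [One, Zero]) *
          word (beta (lucas (2*n-1) + k)) *
          inverse (word [Zero, One]) * word [Zero, Zero, Zero, One]) \<and>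
     (\<forall>n\<ge>2. \<forall>k\<in>{0..lucas (2*n-3)}.
        word (beta (lucas (2*n+1) + lucas (2*n-2) + k)) =
          word [One, Zero, Zero, One, Zero] * inverse (word [One, Zero]) *
          word (beta (lucas (2*n-2) + k)) *
          inverse (word [Zero, One]) * word [Zero, Zero, One, Zero, Zero, One])"
proof (intro conjI allI impI ballI)
  fix n k assume n: "1 \<le> n" and k: "k \<in> {1..lucas (2*n-1)}"
  define m where "m = n - 1"
  have index: "2*n = 2*m+2" "2*n-1 = 2*m+1" "2 * int n = 2 * int m + 2"
    "- 2 * int n = - 2 * int m - 2"
    using n by (simp_all add: m_def)
  have "1 \<le> k" "k \<le> lucas (2*m+1)"
    using k unfolding index by simp_all
  note * = beta_even[OF this]
  show "phi_digits (lucas (2*n) + k) = (\<lambda>i. phi_digits (lucas (2*n)) i + phi_digits k i)"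
    "high_pos k < 2 * int n" "- 2 * int n < low_pos k"
    "beta (lucas (2*n) + k) =
      [One] @ replicate (nat (2 * int n - 1 - high_pos k)) Zero @ beta k @
      replicate (nat (low_pos k - 1 + 2 * int n)) Zero @ [One]"
    unfolding index by (fact *)+
next
  fix n k assume n: "2 \<le> n" and k: "k \<in> {1..lucas (2*n-2) - 1}"
  define m where "m = n - 1"
  have index: "2*n+1 = 2*m+3" "2*n-1 = 2*m+1" "2*n-2 = 2*m"
    using n by (simp_all add: m_def)
  have "lucas (2*m+1) < lucas (2*m+1) + k" "lucas (2*m+1) + k < lucas (2*m+2)"
    using k lucas_rec(1)[of m] unfolding index by auto
  note * = beta_steps_I_K[OF this]
  have sums: "lucas (2*n+1) + k = (lucas (2*m+1) + k) + lucas (2*m+2)"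
    "lucas (2*n+1) + lucas (2*n-1) + k = (lucas (2*m+1) + k) + lucas (2*m+3)"
    using lucas_rec(2)[of m] unfolding index by simp_all
  show "word (beta (lucas (2*n+1) + k)) =
      word [One, Zero, Zero, Zero] * inverse (word [One, Zero]) *
      word (beta (lucas (2*n-1) + k)) *
      inverse (word [Zero, One]) * word [One, Zero, Zero, One]"
    unfolding sums unfolding index(2) by (fact *)
  show "word (beta (lucas (2*n+1) + lucas (2*n-1) + k)) =
      word [One, Zero, One, Zero] * inverse (word [One, Zero]) *
      word (beta (lucas (2*n-1) + k)) *
      inverse (word [Zero, One]) * word [Zero, Zero, Zero, One]"
    unfolding sums unfolding index(2) by (fact *)
next
  fix n k assume n: "2 \<le> n" and k: "k \<in> {0..lucas (2*n-3)}"
  define m where "m = n - 1"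
  have m: "m \<ge> 1" and index: "2*n+1 = 2*m+3" "2*n-2 = 2*m" "2*n-3 = 2*m-1"
    using n by (simp_all add: m_def)
  have "lucas (2*m+1) = lucas (2*m) + lucas (2*m-1)"
    using m by (cases m) simp_all
  then have "lucas (2*m) \<le> lucas (2*m) + k" "lucas (2*m) + k \<le> lucas (2*m+1)"
    using k unfolding index by simp_all
  note * = beta_step_J[OF m this]
  have sum: "lucas (2*n+1) + lucas (2*n-2) + k = (lucas (2*m) + k) + lucas (2*m+3)"
    unfolding index by simp
  show "word (beta (lucas (2*n+1) + lucas (2*n-2) + k)) =
      word [One, Zero, Zero, One, Zero] * inverse (word [One, Zero]) *
      word (beta (lucas (2*n-2) + k)) *
      inverse (word [Zero, One]) * word [Zero, Zero, One, Zero, Zero, One]"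
    unfolding sum unfolding index(2) by (fact *)
qed

end
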